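(* Let $\alpha,\beta$ and $T^\ell>0$ ($\ell\in\Omega$) be given. Consider the constrained problem $$\min\ \mathbb E\,\mathsf T\quad\text{subject to}\quad \mathbb P_0(D_{\mathsf T}=1)\le\alpha,\quad \mathbb P_1(D_{\mathsf T}=0)\le\beta,\quad \mathbb E\Big(\sum_{t=1}^{\mathsf T}\mathbb 1_{\{\delta_t=\ell\}}\Big)\le T^\ell\ \ (\ell\in\Omega),$$ over all procedures $\{\boldsymbol\delta_{1:\mathsf T},D_{\mathsf T},\mathsf T\}$ (infinite-horizon case), or over all procedures with $\mathsf T\le N$ (finite-horizon case, $N\ge1$ fixed). Let $\mu_0,\mu_1\ge 0$ and $\lambda_\ell\ge0$ ($\ell\in\Omega$), and let $\{\boldsymbol\delta^\star_{1:\mathsf T^\star},D^\star_{\mathsf T^\star},\mathsf T^\star\}$ be the optimal procedure, in the infinite-horizon (respectively finite-horizon, $\mathsf T\le N$) case, for the Bayes risk $$\mathcal R(\boldsymbol\delta_{1:\mathsf T},D_{\mathsf T},\mathsf T)=\mathbb E\,\mathsf T+\mu_0\pi_0\mathbb P_0(D_{\mathsf T}=1)+\mu_1\pi_1\mathbb P_1(D_{\mathsf T}=0)+\sum_{\ell\in\Omega}\lambda_\ell\,\mathbb E\Big(\sum_{t=1}^{\mathsf T}\mathbb 1_{\{\delta_t=\ell\}}\Big).$$ Suppose that $\mu_0,\mu_1$ and $\{\lambda_\ell\}_{\ell\in\Omega}$ are chosen such that, for this procedure, (i) the reliability constraints hold with equality: $\mathbb P_0(D^\star_{\mathsf T^\star}=1)=\alpha$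 and $\mathbb P_1(D^\star_{\mathsf T^\star}=0)=\beta$; (ii) all usage constraints are satisfied: $\mathbb E\big(\sum_{t=1}^{\mathsf T^\star}\mathbb 1_{\{\delta^\star_t=\ell\}}\big)\le T^\ell$ for all $\ell\in\Omega$; (iii) the usage constraints hold with equality for every $\ell\in\Omega_c:=\{\ell:\lambda_\ell>0\}$. Then $\{\boldsymbol\delta^\star_{1:\mathsf T^\star},D^\star_{\mathsf T^\star},\mathsf T^\star\}$ solves the constrained problem in the infinite-horizon (respectively finite-horizon) case.
   Context: Model. There are $K$ sensors, $\Pi=\{1,\dots,K\}$, and a binary hypothesis $\mathcal H\in\{0,1\}$ with prior $\mathbb P(\mathcal H=i)=\pi_i$, $\pi_0+\pi_1=1$. Sensor $\ell$ produces samples with known density $f_i^\ell$ under $\mathcal H=i$; no two sensors have identical pairs $(f_0^\ell,f_1^\ell)$. Samples are i.i.d. over time for each sensor and independent across sensors, given $\mathcal H$. At each time $t$ exactly one sensor $\delta_t\in\Pi$ is selected as a function of $X_1,\dots,X_{t-1}$, and then $X_t\sim f_i^{\delta_t}$ given $\mathcal H=i$ and the past. $\Omega\subseteq\Pi$ is the set of usage-constrained sensors. A procedure $\{\boldsymbol\delta_{1:\mathsf T},D_{\mathsf T},\mathsf T\}$ consists of the selections $\boldsymbol\delta_{1:\mathsf T}=(\delta_1,\dots,\delta_{\mathsf T})$; a deterministic stopping rule $\mathsf T$ taking values in $\{0,1,2,\dots\}$ (the event $\{\mathsf T=t\}$ is determined by $X_1,\dots,X_t$); and a decision $D_{\mathsf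 T}\in\{0,1\}$ which on $\{\mathsf T=t\}$ is a function of $X_1,\dots,X_t$. $\mathbb P,\mathbb E$ refer to the joint law of $\mathcal H$ and the samples; $\mathbb P_i,\mathbb E_i$ to the law conditioned on $\mathcal H=i$; in particular $\mathbb E\,\mathsf T=\pi_0\mathbb E_0\mathsf T+\pi_1\mathbb E_1\mathsf T$. The optimal Bayes procedure is the one that minimizes $\mathcal R$ over the relevant class. In the paper it is described as follows, with $L_t=\sum_{s=1}^t\log\frac{f_1^{\delta_s}(X_s)}{f_0^{\delta_s}(X_s)}$. Finite horizon: $\delta^\star_{t+1}=\psi_{t+1}(L_t)$, $\mathsf T^\star=\min\{t:L_t\notin(-A_t,B_t)\}$, deciding $\mathcal H=0$ if $L_{\mathsf T^\star}\le-A_{\mathsf T^\star}$ and $\mathcal H=1$ if $L_{\mathsf T^\star}\ge B_{\mathsf T^\star}$. Infinite horizon: the same with $\psi$, $A$, $B$ independent of time. *)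

theory Defs
  imports "HOL-Probability.Probability" "HOL-Library.Extended_Nat"
begin

text \<open>Sensors are numbered \<open>1..K\<close>. Each density is taken with respect to a common dominating
  measure on an arbitrary observation space (e.g. \<open>lborel\<close> or a counting measure). Hypotheses are
  the numbers 0 and 1.\<close>

record 'x sensor_model =
  num_sensors :: nat
  base :: "'x measure"
  dens :: "nat \<Rightarrow> nat \<Rightarrow> 'x \<Rightarrow> real"  \<comment> \<open>\<open>dens M i l\<close> is $f_i^l$\<close>
  prior :: "nat \<Rightarrow> real"
  constrained :: "nat set"  \<comment> \<open>the usage-constrained sensors $\Omega$\<close>

definition sensors :: "'x sensor_model \<Rightarrow> nat set" where
  "sensors M = {1..num_sensors M}"

definition valid_model :: "'x sensor_model \<Rightarrow> bool" where
  "valid_model M \<longleftrightarrow>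
     sigma_finite_measure (base M) \<and>
     (\<forall>i\<in>{0,1}. \<forall>l\<in>sensors M. dens M i l \<in> borel_measurable (base M) \<and>
        (\<forall>x\<in>space (base M). 0 \<le> dens M i l x) \<and> (\<integral>\<^sup>+x. dens M i l x \<partial>base M) = 1) \<and>
     (\<forall>l\<in>sensors M. \<forall>l'\<in>sensors M. l \<noteq> l' \<longrightarrow>
        \<not> (AE x in base M. dens M 0 l x = dens M 0 l' x \<and> dens M 1 l x = dens M 1 l' x)) \<and>
     0 \<le> prior M 0 \<and> 0 \<le> prior M 1 \<and> prior M 0 + prior M 1 = 1 \<and>
     constrained M \<subseteq> sensors M"

text \<open>A sample point \<open>\<omega>\<close> assigns to \<open>(l, t)\<close> the sample that sensor \<open>l\<close> produces at time \<open>t \<ge> 1\<close>.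
  Given the hypothesis all these samples are independent.\<close>

definition samples :: "'x sensor_model \<Rightarrow> (nat \<times> nat \<Rightarrow> 'x) measure" where
  "samples M = (\<Pi>\<^sub>M lt\<in>sensors M \<times> {1..}. base M)"

definition cond_law :: "'x sensor_model \<Rightarrow> nat \<Rightarrow> (nat \<times> nat \<Rightarrow> 'x) measure" where
  "cond_law M i = (\<Pi>\<^sub>M lt\<in>sensors M \<times> {1..}. density (base M) (dens M i (fst lt)))"

definition joint_law :: "'x sensor_model \<Rightarrow> (nat \<times> (nat \<times> nat \<Rightarrow> 'x)) measure" where
  "joint_law M = point_measure {0, 1} (\<lambda>i. ennreal (prior M i)) \<bind>
     (\<lambda>i. distr (cond_law M i) (count_space {0, 1} \<Otimes>\<^sub>M samples M) (Pair i))"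

definition expect :: "'x sensor_model \<Rightarrow> ((nat \<times> nat \<Rightarrow> 'x) \<Rightarrow> ennreal) \<Rightarrow> ennreal" where
  "expect M F = (\<integral>\<^sup>+(h, \<omega>). F \<omega> \<partial>joint_law M)"


text \<open>The selections, the stopping time and the decision are functions of the sample point; that
  they only use the samples observed so far is imposed by \<open>procedure\<close>. Selections \<open>sel p t\<close> matter
  for \<open>t \<ge> 1\<close> only, the decision only where the stopping time is finite.\<close>

record 'x proc =
  sel :: "nat \<Rightarrow> (nat \<times> nat \<Rightarrow> 'x) \<Rightarrow> nat"
  stop :: "(nat \<times> nat \<Rightarrow> 'x) \<Rightarrow> enat"
  dec :: "(nat \<times> nat \<Rightarrow> 'x) \<Rightarrow> nat"

definition obs :: "'x proc \<Rightarrow> nat \<Rightarrow> (nat \<times> nat \<Rightarrow> 'x) \<Rightarrow> 'x" where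
  "obs p t \<omega> = \<omega> (sel p t \<omega>, t)"

text \<open>The sigma-algebra generated by the first \<open>t\<close> observations \<open>obs p 1, \<dots>, obs p t\<close>.\<close>

definition past :: "'x sensor_model \<Rightarrow> 'x proc \<Rightarrow> nat \<Rightarrow> (nat \<times> nat \<Rightarrow> 'x) measure" where
  "past M p t = vimage_algebra (space (samples M)) (\<lambda>\<omega>. \<lambda>s\<in>{1..t}. obs p s \<omega>)
     (\<Pi>\<^sub>M s\<in>{1..t}. base M)"

text \<open>The stopping time may be infinite on a null set: first exit times of log-likelihood ratios
  are infinite along exceptional sample paths.\<close>

definition procedure :: "'x sensor_model \<Rightarrow> 'x proc \<Rightarrow> bool" where
  "procedure M p \<longleftrightarrow>
     (\<forall>t. sel p (Suc t) \<in> past M p t \<rightarrow>\<^sub>M count_space (sensors M)) \<and>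
     (\<forall>t. {\<omega> \<in> space (samples M). stop p \<omega> = enat t} \<in> sets (past M p t)) \<and>
     (\<forall>i\<in>{0,1}. AE \<omega> in cond_law M i. stop p \<omega> < \<infinity>) \<and>
     (\<forall>t. dec p \<in> restrict_space (past M p t) {\<omega>. stop p \<omega> = enat t} \<rightarrow>\<^sub>M count_space {0, 1})"

text \<open>The horizon \<open>N = \<infinity>\<close> imposes no restriction.\<close>

definition procedures :: "'x sensor_model \<Rightarrow> enat \<Rightarrow> 'x proc set" where
  "procedures M N = {p. procedure M p \<and> (\<forall>\<omega>\<in>space (samples M). stop p \<omega> \<le> N)}"

definition mean_time :: "'x sensor_model \<Rightarrow> 'x proc \<Rightarrow> ennreal" where
  "mean_time M p = expect M (\<lambda>\<omega>. ennreal_of_enat (stop p \<omega>))"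

definition error_prob :: "'x sensor_model \<Rightarrow> 'x proc \<Rightarrow> nat \<Rightarrow> nat \<Rightarrow> real" where
  "error_prob M p i d =
     measure (cond_law M i) {\<omega> \<in> space (samples M). stop p \<omega> < \<infinity> \<and> dec p \<omega> = d}"

definition mean_usage :: "'x sensor_model \<Rightarrow> 'x proc \<Rightarrow> nat \<Rightarrow> ennreal" where
  "mean_usage M p l =
     expect M (\<lambda>\<omega>. \<Sum>t. of_bool (1 \<le> t \<and> enat t \<le> stop p \<omega> \<and> sel p t \<omega> = l))"

definition bayes_risk ::
  "'x sensor_model \<Rightarrow> (nat \<Rightarrow> real) \<Rightarrow> (nat \<Rightarrow> real) \<Rightarrow> 'x proc \<Rightarrow> ennreal" where
  "bayes_risk M mu lam p =
     mean_time M p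
     + ennreal (mu 0 * prior M 0 * error_prob M p 0 1)
     + ennreal (mu 1 * prior M 1 * error_prob M p 1 0)
     + (\<Sum>l\<in>constrained M. ennreal (lam l) * mean_usage M p l)"

definition feasible ::
  "'x sensor_model \<Rightarrow> enat \<Rightarrow> real \<Rightarrow> real \<Rightarrow> (nat \<Rightarrow> real) \<Rightarrow> 'x proc \<Rightarrow> bool" where
  "feasible M N \<alpha> \<beta> tau p \<longleftrightarrow>
     p \<in> procedures M N \<and> error_prob M p 0 1 \<le> \<alpha> \<and> error_prob M p 1 0 \<le> \<beta> \<and>
     (\<forall>l\<in>constrained M. mean_usage M p l \<le> ennreal (tau l))"


lemma sets_cond_law: "sets (cond_law M i) = sets (samples M)"
  unfolding cond_law_def samples_def by (intro sets_PiM_cong) auto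

lemma prob_space_cond_law:
  assumes "valid_model M" "i \<in> {0, 1}"
  shows "prob_space (cond_law M i)"
  unfolding cond_law_def
proof (rule prob_space_PiM)
  fix lt assume "lt \<in> sensors M \<times> {1::nat..}"
  then have "dens M i (fst lt) \<in> borel_measurable (base M)"
    and "(\<integral>\<^sup>+x. dens M i (fst lt) x \<partial>base M) = 1"
    using assms unfolding valid_model_def by auto
  then show "prob_space (density (base M) (dens M i (fst lt)))"
    by (intro prob_spaceI) (simp add: emeasure_density cong: nn_integral_cong)
qed

lemma measurable_Pair_law:
  assumes "i \<in> {0, 1}"
  shows "Pair i \<in> cond_law M i \<rightarrow>\<^sub>M count_space {0, 1} \<Otimes>\<^sub>M samples M"
proof -
  have "Pair i \<in> samples M \<rightarrow>\<^sub>M count_space {0, 1} \<Otimes>\<^sub>M samples M"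
    using assms by (intro measurable_Pair1') auto
  then show ?thesis
    using measurable_cong_sets[OF sets_cond_law refl] by blast
qed

lemma nn_integral_joint_law:
  assumes "valid_model M" "G \<in> borel_measurable (count_space {0, 1} \<Otimes>\<^sub>M samples M)"
  shows "(\<integral>\<^sup>+z. G z \<partial>joint_law M) =
    prior M 0 * (\<integral>\<^sup>+\<omega>. G (0, \<omega>) \<partial>cond_law M 0) + prior M 1 * (\<integral>\<^sup>+\<omega>. G (1, \<omega>) \<partial>cond_law M 1)"
proof -
  let ?B = "count_space {0::nat, 1} \<Otimes>\<^sub>M samples M"
  let ?N = "\<lambda>i. distr (cond_law M i) ?B (Pair i)"
  let ?H = "point_measure {0::nat, 1} (\<lambda>i. ennreal (prior M i))"
  have "prob_space (?N i)" if "i \<in> {0, 1}" for i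
    using prob_space.prob_space_distr[OF prob_space_cond_law[OF assms(1) that] measurable_Pair_law[OF that]] .
  then have "?N i \<in> space (subprob_algebra ?B)" if "i \<in> {0, 1}" for i
    using that by (auto simp: space_subprob_algebra prob_space_imp_subprob_space)
  then have N: "?N \<in> ?H \<rightarrow>\<^sub>M subprob_algebra ?B"
    by (auto simp: measurable_def space_point_measure sets_point_measure)
  have "(\<integral>\<^sup>+z. G z \<partial>joint_law M) = (\<integral>\<^sup>+i. (\<integral>\<^sup>+z. G z \<partial>?N i) \<partial>?H)"
    unfolding joint_law_def by (rule nn_integral_bind[OF assms(2) N])
  also have "\<dots> = (\<Sum>i\<in>{0,1}. ennreal (prior M i) * (\<integral>\<^sup>+z. G z \<partial>?N i))"
    by (subst nn_integral_point_measure_finite) (auto simp: mult.commute)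
  also have "\<dots> = (\<Sum>i\<in>{0,1}. ennreal (prior M i) * (\<integral>\<^sup>+\<omega>. G (i, \<omega>) \<partial>cond_law M i))"
    by (intro sum.cong refl arg_cong2[where f = "(*)"] nn_integral_distr measurable_Pair_law)
      (use assms(2) in simp_all)
  finally show ?thesis by simp
qed

lemma expect_eq:
  assumes "valid_model M" "F \<in> borel_measurable (samples M)"
  shows "expect M F =
    prior M 0 * (\<integral>\<^sup>+\<omega>. F \<omega> \<partial>cond_law M 0) + prior M 1 * (\<integral>\<^sup>+\<omega>. F \<omega> \<partial>cond_law M 1)"
  unfolding expect_def
  by (subst nn_integral_joint_law) (use assms in \<open>auto simp: case_prod_beta\<close>)

text \<open>\<open>cond_law M i\<close> is the conditional law of the samples given that the hypothesis is \<open>i\<close>.\<close>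

lemma emeasure_joint_law:
  assumes "valid_model M" "i \<in> {0, 1}" "A \<in> sets (samples M)"
  shows "emeasure (joint_law M) ({i} \<times> A) = prior M i * emeasure (cond_law M i) A"
proof -
  let ?B = "count_space {0::nat, 1} \<Otimes>\<^sub>M samples M"
  have S: "{i} \<times> A \<in> sets ?B"
    using assms by (intro pair_measureI) auto
  have "sets (joint_law M) = sets ?B"
    unfolding joint_law_def by (rule sets_bind[OF sets_distr]) (simp add: space_point_measure)
  then have "emeasure (joint_law M) ({i} \<times> A) = (\<integral>\<^sup>+z. indicator ({i} \<times> A) z \<partial>joint_law M)"
    using S by simp
  also have "\<dots> = prior M 0 * (\<integral>\<^sup>+\<omega>. indicator ({i} \<times> A) (0, \<omega>) \<partial>cond_law M 0)
      + prior M 1 * (\<integral>\<^sup>+\<omega>. indicator ({i} \<times> A) (1, \<omega>) \<partial>cond_law M 1)"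
    by (rule nn_integral_joint_law[OF assms(1) borel_measurable_indicator[OF S]])
  also have "\<dots> = prior M i * (\<integral>\<^sup>+\<omega>. indicator A \<omega> \<partial>cond_law M i)"
    using assms(2) by (auto simp: indicator_times)
  also have "\<dots> = prior M i * emeasure (cond_law M i) A"
    using assms(3) by (simp add: sets_cond_law)
  finally show ?thesis .
qed

lemma sets_past_subset:
  assumes "procedure M p"
  shows "sets (past M p t) \<subseteq> sets (samples M)"
proof (induction t rule: less_induct)
  case (less t)
  have obs: "obs p s \<in> samples M \<rightarrow>\<^sub>M base M" if s: "s \<in> {1..t}" for s
  proof -
    obtain u where u: "s = Suc u" "u < t"
      using s by (cases s) auto
    have "sel p s \<in> past M p u \<rightarrow>\<^sub>M count_space (sensors M)"
      using assms u by (simp add: procedure_def)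
    moreover have "space (past M p u) = space (samples M)"
      by (simp add: past_def)
    ultimately have sel: "sel p s \<in> samples M \<rightarrow>\<^sub>M count_space (sensors M)"
      using less.IH[OF u(2)] by (auto simp: measurable_def)
    have "(\<lambda>\<omega>. (\<lambda>l \<omega>. \<omega> (l, s)) (sel p s \<omega>) \<omega>) \<in> samples M \<rightarrow>\<^sub>M base M"
    proof (rule measurable_compose_countable'[OF _ sel])
      show "(\<lambda>\<omega>. \<omega> (l, s)) \<in> samples M \<rightarrow>\<^sub>M base M" if "l \<in> sensors M" for l
        unfolding samples_def using that s by (intro measurable_component_singleton) auto
      show "countable (sensors M)"
        by (simp add: sensors_def)
    qed
    then show ?thesis
      by (simp add: obs_def[abs_def])
  qed
  have hist: "(\<lambda>\<omega>. \<lambda>s\<in>{1..t}. obs p s \<omega>) \<in> samples M \<rightarrow>\<^sub>M (\<Pi>\<^sub>M s\<in>{1..t}. base M)"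
    by (rule measurable_restrict) (rule obs)
  have "(\<lambda>\<omega>. \<lambda>s\<in>{1..t}. obs p s \<omega>) \<in> space (samples M) \<rightarrow> space (\<Pi>\<^sub>M s\<in>{1..t}. base M)"
    using measurable_space[OF hist] by blast
  then show ?case
    unfolding past_def by (subst sets_vimage_algebra2) (use measurable_sets[OF hist] in blast)+
qed

lemma mean_time_eq:
  assumes "valid_model M" "procedure M p"
  shows "mean_time M p =
    prior M 0 * (\<integral>\<^sup>+\<omega>. ennreal_of_enat (stop p \<omega>) \<partial>cond_law M 0)
    + prior M 1 * (\<integral>\<^sup>+\<omega>. ennreal_of_enat (stop p \<omega>) \<partial>cond_law M 1)"
  unfolding mean_time_def
proof (rule expect_eq[OF assms(1)])
  have fin: "stop p -` {enat t} \<inter> space (samples M) \<in> sets (samples M)" for t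
  proof -
    have "{\<omega> \<in> space (samples M). stop p \<omega> = enat t} \<in> sets (samples M)"
      using assms(2) sets_past_subset[OF assms(2)] by (auto simp: procedure_def)
    also have "{\<omega> \<in> space (samples M). stop p \<omega> = enat t} = stop p -` {enat t} \<inter> space (samples M)"
      by auto
    finally show ?thesis .
  qed
  have "stop p -` {\<infinity>} \<inter> space (samples M) =
      space (samples M) - (\<Union>t. stop p -` {enat t} \<inter> space (samples M))"
    by (auto simp: not_infinity_eq)
  also have "\<dots> \<in> sets (samples M)"
    using fin by blast
  finally have "stop p -` {n} \<inter> space (samples M) \<in> sets (samples M)" for n
    using fin by (cases n) auto
  then have "stop p \<in> samples M \<rightarrow>\<^sub>M count_space UNIV"
    by (simp add: measurable_count_space_eq2_countable)
  then show "(\<lambda>\<omega>. ennreal_of_enat (stop p \<omega>)) \<in> borel_measurable (samples M)"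
    by (rule measurable_compose) simp
qed

end

theory Submission
  imports Defs
begin

text \<open>Weak Lagrangian duality: complementary slackness makes the penalty of \<open>p\<close> equal to its value at
  the constraint bounds, so no feasible procedure has a larger penalty. As that penalty is finite, it
  can be cancelled even when the mean times are infinite.\<close>

definition penalty ::
  "'x sensor_model \<Rightarrow> (nat \<Rightarrow> real) \<Rightarrow> (nat \<Rightarrow> real) \<Rightarrow> 'x proc \<Rightarrow> ennreal" where
  "penalty M mu lam p =
     ennreal (mu 0 * prior M 0 * error_prob M p 0 1)
     + ennreal (mu 1 * prior M 1 * error_prob M p 1 0)
     + (\<Sum>l\<in>constrained M. ennreal (lam l) * mean_usage M p l)"

lemma bayes_risk_eq_penalty: "bayes_risk M mu lam p = mean_time M p + penalty M mu lam p"
  by (simp add: bayes_risk_def penalty_def add.assoc)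

text \<open>Usages are compared only where \<open>0 < lam l\<close>: on the other sensors a feasible
  \<open>q\<close> may well use more than \<open>p\<close>, but there the usage carries no
  weight.\<close>

lemma penalty_mono:
  assumes "valid_model M" "0 \<le> mu 0" "0 \<le> mu 1"
    and "error_prob M q 0 1 \<le> error_prob M p 0 1" "error_prob M q 1 0 \<le> error_prob M p 1 0"
    and "\<And>l. l \<in> constrained M \<Longrightarrow> 0 < lam l \<Longrightarrow> mean_usage M q l \<le> mean_usage M p l"
  shows "penalty M mu lam q \<le> penalty M mu lam p"
proof -
  have "0 \<le> prior M 0" "0 \<le> prior M 1"
    using assms(1) by (auto simp: valid_model_def)
  \<comment> \<open>For \<open>lam l \<le> 0\<close> the weight \<open>ennreal (lam l)\<close> is 0,
    so both products vanish even if a usage is infinite.\<close>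
  moreover have "ennreal (lam l) * mean_usage M q l \<le> ennreal (lam l) * mean_usage M p l"
    if "l \<in> constrained M" for l
    using assms(6)[OF that] by (cases "0 < lam l") (auto simp: ennreal_neg intro: mult_left_mono)
  ultimately show ?thesis
    unfolding penalty_def using assms(2-5)
    by (intro add_mono sum_mono ennreal_leI mult_left_mono[of "error_prob _ _ _ _"]) auto
qed

lemma penalty_less_top:
  assumes "valid_model M"
    and "\<And>l. l \<in> constrained M \<Longrightarrow> mean_usage M p l < \<top>"
  shows "penalty M mu lam p < \<top>"
proof -
  have "finite (constrained M)"
    using assms(1) finite_subset by (auto simp: valid_model_def sensors_def)
  then show ?thesis
    using assms(2) by (simp add: penalty_def ennreal_mult_less_top less_top)
qed

text \<open>One argument serves both horizons, since \<open>p\<close> and its competitors lie in the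
  same class \<open>procedures M N\<close>.\<close>

theorem theorem3:
  fixes M :: "'x sensor_model" and N :: enat and \<alpha> \<beta> :: real
    and tau mu lam :: "nat \<Rightarrow> real" and p :: "'x proc"
  assumes model: "valid_model M"
    and horizon: "1 \<le> N"
    and tau_pos: "\<forall>l\<in>constrained M. 0 < tau l"
    and mu_nonneg: "0 \<le> mu 0" "0 \<le> mu 1"
    and lam_nonneg: "\<forall>l\<in>constrained M. 0 \<le> lam l"
    and bayes_optimal: "is_arg_min (bayes_risk M mu lam) (\<lambda>q. q \<in> procedures M N) p"
    and reliability: "error_prob M p 0 1 = \<alpha>" "error_prob M p 1 0 = \<beta>"
    and usage: "\<forall>l\<in>constrained M. mean_usage M p l \<le> ennreal (tau l)"
    and active: "\<forall>l\<in>constrained M. 0 < lam l \<longrightarrow> mean_usage M p l = ennreal (tau l)"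
  shows "is_arg_min (mean_time M) (feasible M N \<alpha> \<beta> tau) p"
proof -
  have p: "p \<in> procedures M N"
    and opt: "\<And>q. q \<in> procedures M N \<Longrightarrow> bayes_risk M mu lam p \<le> bayes_risk M mu lam q"
    using bayes_optimal by (auto simp: is_arg_min_linorder)
  have fin: "penalty M mu lam p < \<top>"
    using usage by (intro penalty_less_top[OF model]) (auto intro: le_less_trans)
  have "mean_time M p \<le> mean_time M q" if q: "feasible M N \<alpha> \<beta> tau q" for q
  proof -
    have "mean_time M p + penalty M mu lam p \<le> mean_time M q + penalty M mu lam q"
      using opt q by (simp add: feasible_def bayes_risk_eq_penalty)
    \<comment> \<open>Complementary slackness enters here: where \<open>0 < lam l\<close>, the bound
      \<open>tau l\<close> on the usage of \<open>q\<close> is the usage of \<open>p\<close> itself,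
      just as \<alpha> and \<beta> are the error probabilities of \<open>p\<close>.\<close>
    also have "\<dots> \<le> mean_time M q + penalty M mu lam p"
      using q reliability active
      by (intro add_left_mono penalty_mono model mu_nonneg) (auto simp: feasible_def)
    \<comment> \<open>Cancelling in \<open>ennreal\<close> leaves the case of an infinite common
      summand, which \<open>fin\<close> excludes.\<close>
    finally show ?thesis
      using fin by (auto simp: add.commute[of _ "penalty M mu lam p"] ennreal_add_left_cancel_le)
  qed
  moreover have "feasible M N \<alpha> \<beta> tau p"
    using p reliability usage by (simp add: feasible_def)
  ultimately show ?thesis
    by (simp add: is_arg_min_linorder)
qed

end
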